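(* For every integer $k\geq 4$, $\mathcal{S}_{3s}(2,k)\subseteq\mathbb{N}\setminus\{1,2,\dots,2k-1\}$; that is, every $3$-way $(v,k,2)$ Steiner trade of positive volume $m$ has $m\geq 2k$.
   Context: Let $V$ be a set of $v$ elements and let $k,t$ be positive integers with $t<k<v$. A block is a $k$-subset of $V$. A $\mu$-way $(v,k,t)$ trade of volume $m$ is a family $T=\{T_1,\dots,T_\mu\}$ of $\mu$ pairwise disjoint collections of blocks, each $T_i$ consisting of exactly $m$ blocks, such that for every $t$-subset $S$ of $V$, the number of blocks of $T_i$ containing $S$ is the same for all $i$. It is a Steiner trade if every $t$-subset of $V$ is contained in at most one block of each $T_i$. $\mathcal{S}_{\mu s}(t,k)$ denotes the set of all positive integers $m$ such that a $\mu$-way $(v,k,t)$ Steiner trade of volume $m$ exists for some $v$. Here $\mathbb{N}=\{1,2,3,\dots\}$. *)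

theory Defs
  imports "HOL-Library.Ramsey" "HOL-Library.Disjoint_Sets"
begin

text \<open>
  The blocks are the elements of \<^term>\<open>nsets V k\<close>, the \<open>k\<close>-subsets of \<open>V\<close>, and
  \<open>v = card V\<close>.  The collections \<open>T\<^sub>1, \<dots>, T\<^sub>\<mu>\<close> are the values of \<open>T\<close> on \<open>{1..\<mu>}\<close>;
  \<open>T\<close> is unconstrained elsewhere.
\<close>

definition way_trade :: "nat \<Rightarrow> 'a set \<Rightarrow> nat \<Rightarrow> nat \<Rightarrow> nat \<Rightarrow> (nat \<Rightarrow> 'a set set) \<Rightarrow> bool" where
  "way_trade \<mu> V k t m T \<longleftrightarrow>
     finite V \<and> 0 < t \<and> t < k \<and> k < card V \<and>
     (\<forall>i\<in>{1..\<mu>}. T i \<subseteq> nsets V k \<and> card (T i) = m) \<and>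
     disjoint_family_on T {1..\<mu>} \<and>
     (\<forall>S\<in>nsets V t. \<forall>i\<in>{1..\<mu>}. \<forall>j\<in>{1..\<mu>}.
        card {B \<in> T i. S \<subseteq> B} = card {B \<in> T j. S \<subseteq> B})"

definition steiner_way_trade ::
  "nat \<Rightarrow> 'a set \<Rightarrow> nat \<Rightarrow> nat \<Rightarrow> nat \<Rightarrow> (nat \<Rightarrow> 'a set set) \<Rightarrow> bool" where
  "steiner_way_trade \<mu> V k t m T \<longleftrightarrow>
     way_trade \<mu> V k t m T \<and>
     (\<forall>S\<in>nsets V t. \<forall>i\<in>{1..\<mu>}. card {B \<in> T i. S \<subseteq> B} \<le> 1)"

text \<open>
  Every finite point set is in bijection with a set of natural numbers, so letting \<open>V\<close>
  range over finite sets of natural numbers covers every \<open>v\<close>.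
\<close>

definition steiner_volumes :: "nat \<Rightarrow> nat \<Rightarrow> nat \<Rightarrow> nat set" where
  "steiner_volumes \<mu> t k =
     {m. 0 < m \<and> (\<exists>(V :: nat set) T. steiner_way_trade \<mu> V k t m T)}"

end

theory Submission
  imports Defs
begin

text \<open>
  If every point of a block \<open>B\<close> lies on at least three blocks of \<open>T 1\<close>, the blocks of \<open>T 1\<close>
  meeting \<open>B\<close> already number at least \<open>2 * k + 1\<close>.  Otherwise some point \<open>x\<close> lies on exactly two
  blocks of \<open>T 1\<close>; removing \<open>x\<close> leaves disjoint sets \<open>N\<close> and \<open>M\<close> of \<open>k - 1\<close> points, and \<open>T 2\<close>
  and \<open>T 3\<close> induce two further partitions of \<open>N \<union> M\<close> into \<open>(k - 1)\<close>-sets, no set being shared.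
  A pair in \<open>N \<times> M\<close> that lies in a set of either partition is covered by a block of \<open>T 1\<close>
  avoiding \<open>x\<close>, and different pairs need different blocks.  There are at least \<open>2 * (k - 1)\<close> such
  pairs, which with the two blocks through \<open>x\<close> gives \<open>2 * k\<close>.
\<close>

section \<open>Cross pairs covered by two partitions\<close>

text \<open>If every point of \<open>N\<close> is joined to at least two points of \<open>M\<close>,
  summing over \<open>N\<close> suffices. Otherwise some \<open>p\<close> has a single neighbour
  \<open>q\<close>, which forces both partitions to arise from \<open>{N, M}\<close> by swapping
  \<open>q\<close> with a point of \<open>N\<close>: \<open>a\<close> for \<open>P\<close>,
  \<open>b\<close> for \<open>Q\<close>. Then \<open>a\<close> and \<open>b\<close> are each joined
  to all of \<open>M\<close>.\<close>

lemma card_cross_pairs_two_partitions: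
  assumes fin: "finite N" "finite M" and card: "card N = n" "card M = n" and NM: "N \<inter> M = {}"
    and P: "partition_on (N \<union> M) P" "\<And>C. C \<in> P \<Longrightarrow> card C = n" "N \<notin> P"
    and Q: "partition_on (N \<union> M) Q" "\<And>D. D \<in> Q \<Longrightarrow> card D = n" "N \<notin> Q"
    and PQ: "P \<inter> Q = {}"
  shows "2 * n \<le> card {(p, q). p \<in> N \<and> q \<in> M \<and> (\<exists>C\<in>P \<union> Q. p \<in> C \<and> q \<in> C)}"
proof -
  define E where "E p = {q \<in> M. \<exists>C\<in>P \<union> Q. p \<in> C \<and> q \<in> C}" for p
  have finE: "finite (E p)" for p
    using fin by (simp add: E_def)
  have "{(p, q). p \<in> N \<and> q \<in> M \<and> (\<exists>C\<in>P \<union> Q. p \<in> C \<and> q \<in> C)} = Sigma N E"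
    unfolding E_def Sigma_def by fast
  then have cardE: "card {(p, q). p \<in> N \<and> q \<in> M \<and> (\<exists>C\<in>P \<union> Q. p \<in> C \<and> q \<in> C)}
      = (\<Sum>p\<in>N. card (E p))"
    using fin finE by (simp add: card_SigmaI)
  have meets: "\<exists>q. q \<in> C \<inter> M" if "C \<in> R" "partition_on (N \<union> M) R" "card C = n" "N \<notin> R" for C R
  proof (rule ccontr)
    assume "\<not> ?thesis"
    moreover have "C \<subseteq> N \<union> M"
      using that partition_onD1 by fastforce
    ultimately have "C \<subseteq> N" by blast
    then have "C = N"
      using fin(1) card(1) that(3) by (simp add: card_subset_eq)
    then show False using that by simp
  qed
  \<comment> \<open>\<open>C\<close> has \<open>n - 1\<close> points in \<open>N\<close> and so
    misses just one, \<open>a\<close>. What \<open>C\<close> leaves of \<open>N \<union> M\<close>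
    has \<open>n\<close> points, hence is the set of \<open>R\<close> containing
    \<open>a\<close>.\<close>
  have rest: "\<exists>a C'. a \<in> N \<and> C = insert q (N - {a}) \<and> C' \<in> R \<and> C' = insert a (M - {q})"
    if C: "C \<in> R" and R: "partition_on (N \<union> M) R" "\<And>C. C \<in> R \<Longrightarrow> card C = n"
      and q: "C \<inter> M = {q}" for C R q
  proof -
    have qM: "q \<in> M" "q \<notin> N" using q NM by auto
    have CNM: "C \<subseteq> N \<union> M" using C partition_onD1[OF R(1)] by auto
    then have Ceq: "C = insert q (C \<inter> N)" using q by auto
    have "finite (C \<inter> N)" using fin by simp
    then have "card C = Suc (card (C \<inter> N))"
      using Ceq qM by (metis IntD2 card_insert_disjoint)
    then have "card (N - C) = 1"
      using R(2)[OF C] card(1) fin(1) by (simp add: card_Diff_subset_Int Int_commute)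
    then obtain a where a: "N - C = {a}" by (meson card_1_singletonE)
    then obtain C' where C': "C' \<in> R" "a \<in> C'"
      using partition_onD1[OF R(1)] by blast
    have "C' \<inter> C = {}"
      using C C' a partition_onD2[OF R(1)] by (auto simp: disjoint_def)
    moreover have "C' \<subseteq> N \<union> M" using C' partition_onD1[OF R(1)] by auto
    ultimately have "C' \<subseteq> insert a (M - {q})" using a q by blast
    moreover have "card (insert a (M - {q})) = n"
    proof -
      have "a \<notin> M" using a NM by blast
      then show ?thesis
        using fin card qM by (metis DiffE card_Suc_Diff1 card_insert_disjoint finite_Diff)
    qed
    ultimately have "C' = insert a (M - {q})"
      using R(2)[OF C'(1)] fin by (simp add: card_subset_eq)
    moreover have "C = insert q (N - {a})" using Ceq a by blast
    ultimately show ?thesis using a C' by blast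
  qed
  show ?thesis
  proof (cases "\<forall>p\<in>N. 2 \<le> card (E p)")
    case True
    then have "(\<Sum>p\<in>N. 2) \<le> (\<Sum>p\<in>N. card (E p))"
      by (intro sum_mono) simp
    then show ?thesis unfolding cardE using card by simp
  next
    case False
    then obtain p where p: "p \<in> N" "card (E p) \<le> 1" by auto
    obtain C where C: "C \<in> P" "p \<in> C" using p partition_onD1[OF P(1)] by blast
    obtain D where D: "D \<in> Q" "p \<in> D" using p partition_onD1[OF Q(1)] by blast
    obtain q where q: "q \<in> C \<inter> M" using meets[OF C(1) P(1) P(2)[OF C(1)] P(3)] by blast
    obtain q' where q': "q' \<in> D \<inter> M" using meets[OF D(1) Q(1) Q(2)[OF D(1)] Q(3)] by blast
    have one: "u = v" if "u \<in> E p" "v \<in> E p" for u v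
      using p(2) finE that by (metis One_nat_def card_le_Suc0_iff_eq)
    have sub: "C \<inter> M \<subseteq> E p" "D \<inter> M \<subseteq> E p" using C D by (auto simp: E_def)
    have Cq: "C \<inter> M = {q}" and Dq: "D \<inter> M = {q}"
      using q q' one sub by blast+
    obtain a C' where a: "a \<in> N" "C = insert q (N - {a})" "C' \<in> P" "C' = insert a (M - {q})"
      using rest[OF C(1) P(1,2) Cq] by blast
    obtain b D' where b: "b \<in> N" "D = insert q (N - {b})" "D' \<in> Q" "D' = insert b (M - {q})"
      using rest[OF D(1) Q(1,2) Dq] by blast
    \<comment> \<open>Equality would give \<open>C = D\<close>, a set common to both
      partitions.\<close>
    have ab: "a \<noteq> b" using a(2) b(2) C(1) D(1) PQ by blast
    have "q \<in> C" "q \<in> D" using Cq Dq by blast+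
    have "a \<in> D" "b \<in> C" using a(1,2) b(1,2) ab by blast+
    have E: "y \<in> E z" if "y \<in> M" "X \<in> P \<union> Q" "z \<in> X" "y \<in> X" for y z X
      using that unfolding E_def by blast
    \<comment> \<open>\<open>D\<close> joins \<open>a\<close> to \<open>q\<close> and
      \<open>C'\<close> joins it to the rest of \<open>M\<close>; \<open>C\<close> and
      \<open>D'\<close> do the same for \<open>b\<close>.\<close>
    have "y \<in> E a \<and> y \<in> E b" if "y \<in> M" for y
    proof (cases "y = q")
      case True
      then show ?thesis
        using E[of y D a] E[of y C b] that C(1) D(1) \<open>q \<in> C\<close> \<open>q \<in> D\<close> \<open>a \<in> D\<close> \<open>b \<in> C\<close> by simp
    next
      case False
      then show ?thesis
        using E[of y C' a] E[of y D' b] that a(3,4) b(3,4) by simp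
    qed
    then have "E a = M" "E b = M" by (auto simp: E_def)
    then have "(\<Sum>p\<in>{a, b}. card (E p)) = 2 * n" using ab card by simp
    moreover have "(\<Sum>p\<in>{a, b}. card (E p)) \<le> (\<Sum>p\<in>N. card (E p))"
      using a(1) b(1) fin by (intro sum_mono2) auto
    ultimately show ?thesis unfolding cardE by simp
  qed
qed

section \<open>Steiner trades and the partitions derived at a point\<close>

locale steiner_3_trade =
  fixes V :: "'a set" and k m :: nat and T :: "nat \<Rightarrow> 'a set set"
  assumes trade: "steiner_way_trade 3 V k 2 m T" and pos: "0 < m"
begin

definition star :: "nat \<Rightarrow> 'a \<Rightarrow> 'a set set" where
  "star i x = {B \<in> T i. x \<in> B}"

definition derived :: "nat \<Rightarrow> 'a \<Rightarrow> 'a set set" where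
  "derived i x = (\<lambda>B. B - {x}) ` star i x"

lemma k_gt_2: "2 < k"
  using trade by (simp add: steiner_way_trade_def way_trade_def)

lemma card_T: "i \<in> {1..3} \<Longrightarrow> card (T i) = m"
  using trade by (simp add: steiner_way_trade_def way_trade_def)

lemma finite_T: "i \<in> {1..3} \<Longrightarrow> finite (T i)"
  using card_T pos card_ge_0_finite by metis

lemma block: "i \<in> {1..3} \<Longrightarrow> B \<in> T i \<Longrightarrow> finite B \<and> card B = k \<and> B \<subseteq> V"
  using trade unfolding steiner_way_trade_def way_trade_def nsets_def by blast

lemma T_disjoint: "i \<in> {1..3} \<Longrightarrow> j \<in> {1..3} \<Longrightarrow> i \<noteq> j \<Longrightarrow> T i \<inter> T j = {}"
  using trade by (auto simp: steiner_way_trade_def way_trade_def disjoint_family_on_def)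

lemma pair_unique:
  assumes i: "i \<in> {1..3}" and "B \<in> T i" "C \<in> T i" "x \<in> B" "y \<in> B" "x \<in> C" "y \<in> C" "x \<noteq> y"
  shows "B = C"
proof -
  have "{x, y} \<in> nsets V 2"
    using assms block[OF i, of B] by (auto simp: nsets_def)
  then have "card {B \<in> T i. {x, y} \<subseteq> B} \<le> 1"
    using trade i unfolding steiner_way_trade_def by blast
  moreover have "finite {B \<in> T i. {x, y} \<subseteq> B}" using finite_T[OF i] by simp
  ultimately show ?thesis
    using assms by (simp add: card_le_Suc0_iff_eq)
qed

text \<open>The balance condition enters only in this form: a positive count in \<open>T i\<close>
  is a positive count in \<open>T j\<close>.\<close>

lemma pair_covered:
  assumes i: "i \<in> {1..3}" and j: "j \<in> {1..3}" and B: "B \<in> T i" "x \<in> B" "y \<in> B" "x \<noteq> y"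
  obtains C where "C \<in> T j" "x \<in> C" "y \<in> C"
proof -
  have "{x, y} \<in> nsets V 2"
    using B block[OF i, of B] by (auto simp: nsets_def)
  then have "card {B \<in> T i. {x, y} \<subseteq> B} = card {B \<in> T j. {x, y} \<subseteq> B}"
    using trade i j unfolding steiner_way_trade_def way_trade_def by blast
  moreover have "card {B \<in> T i. {x, y} \<subseteq> B} \<noteq> 0"
    using B finite_T[OF i] by auto
  ultimately have "{B \<in> T j. {x, y} \<subseteq> B} \<noteq> {}" by (metis card.empty)
  then show ?thesis using that by auto
qed

lemma card_derived_block: "i \<in> {1..3} \<Longrightarrow> B \<in> derived i x \<Longrightarrow> finite B \<and> card B = k - 1"
  using block by (auto simp: derived_def star_def)

text \<open>Members meeting in a point come from blocks sharing a pair through \<open>x\<close>, so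
  the Steiner condition makes them disjoint. Their union is the set of points covered together with
  \<open>x\<close>, which is the same for all three collections.\<close>

lemma partition_derived:
  assumes i: "i \<in> {1..3}" and j: "j \<in> {1..3}"
  shows "partition_on (\<Union>(derived j x)) (derived i x)"
proof (rule partition_onI)
  have le: "\<Union>(derived i x) \<subseteq> \<Union>(derived j x)" if ij: "i \<in> {1..3}" "j \<in> {1..3}" for i j
  proof
    fix y assume "y \<in> \<Union>(derived i x)"
    then obtain B where "B \<in> T i" "x \<in> B" "y \<in> B" "x \<noteq> y"
      by (auto simp: derived_def star_def)
    then obtain C where "C \<in> T j" "x \<in> C" "y \<in> C"
      using pair_covered[OF ij] by metis
    then show "y \<in> \<Union>(derived j x)"
      using \<open>x \<noteq> y\<close> by (auto simp: derived_def star_def)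
  qed
  show "\<Union>(derived i x) = \<Union>(derived j x)"
    using le i j by blast
  show "disjnt p q" if "p \<in> derived i x" "q \<in> derived i x" "p \<noteq> q" for p q
    using that pair_unique[OF i] unfolding derived_def star_def disjnt_def by blast
  show "{} \<notin> derived i x"
    using card_derived_block[OF i, of "{}" x] k_gt_2 by auto
qed

text \<open>Putting \<open>x\<close> back recovers the block, so a common member would be a block
  common to \<open>T i\<close> and \<open>T j\<close>.\<close>

lemma derived_disjoint:
  assumes "i \<in> {1..3}" "j \<in> {1..3}" "i \<noteq> j"
  shows "derived i x \<inter> derived j x = {}"
proof -
  have False if DD: "D \<in> derived i x" "D \<in> derived j x" for D
  proof -
    obtain B C where "B \<in> star i x" "D = B - {x}" "C \<in> star j x" "D = C - {x}"
      using DD unfolding derived_def by (elim imageE) metis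
    moreover then have "B = C"
      unfolding star_def by (metis (lifting) insert_Diff mem_Collect_eq)
    ultimately show False
      using T_disjoint[OF assms] by (auto simp: star_def)
  qed
  then show ?thesis by blast
qed

section \<open>Volume bounds from the number of blocks through a point\<close>

lemma finite_star: "i \<in> {1..3} \<Longrightarrow> finite (star i x)"
  using finite_T by (simp add: star_def)

text \<open>If \<open>B\<close> were the only block of \<open>T 1\<close> through \<open>x\<close>,
  then \<open>derived 2 x\<close> would partition the \<open>(k - 1)\<close>-set
  \<open>B - {x}\<close> into \<open>(k - 1)\<close>-sets, hence contain it, against
  \<open>derived_disjoint\<close>.\<close>

lemma two_le_card_star:
  assumes B: "B \<in> T 1" "x \<in> B"
  shows "2 \<le> card (star 1 x)"
proof (rule ccontr)
  assume "\<not> ?thesis"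
  then have "card (star 1 x) \<le> Suc 0" by simp
  moreover have Bs: "B \<in> star 1 x" using B by (simp add: star_def)
  ultimately have "star 1 x = {B}"
    using finite_star[of 1 x] by (auto simp: card_le_Suc0_iff_eq)
  then have d1: "derived 1 x = {B - {x}}" by (simp add: derived_def)
  then have part: "partition_on (B - {x}) (derived 2 x)"
    using partition_derived[of 2 1 x] by simp
  have B1: "finite (B - {x})" "card (B - {x}) = k - 1"
    using card_derived_block[of 1 _ x] d1 by auto
  then have "B - {x} \<noteq> {}"
    using k_gt_2 by (metis card.empty diff_is_0_eq not_less numeral_2_eq_2 Suc_lessD One_nat_def)
  then obtain C where C: "C \<in> derived 2 x"
    using partition_onD1[OF part] by blast
  then have "C \<subseteq> B - {x}" using partition_onD1[OF part] by blast
  then have "C = B - {x}"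
    using B1 card_derived_block[OF _ C] by (simp add: card_subset_eq)
  then show False using C d1 derived_disjoint[of 1 2 x] by auto
qed

text \<open>A block other than \<open>B\<close> meets \<open>B\<close> in at most one point, so the
  sets \<open>?S x\<close> are disjoint and supply \<open>2 * k\<close> blocks besides
  \<open>B\<close>.\<close>

lemma volume_if_all_stars_large:
  assumes B: "B \<in> T 1" and large: "\<And>x. x \<in> B \<Longrightarrow> 3 \<le> card (star 1 x)"
  shows "2 * k < m"
proof -
  let ?S = "\<lambda>x. star 1 x - {B}"
  have fin: "finite (T 1)" using finite_T by simp
  have Bk: "finite B" "card B = k" using block[of 1 B] B by auto
  have "2 * k = (\<Sum>x\<in>B. 2)" using Bk by simp
  also have "\<dots> \<le> (\<Sum>x\<in>B. card (?S x))"
  proof (rule sum_mono)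
    fix x assume x: "x \<in> B"
    then have "B \<in> star 1 x" using B by (simp add: star_def)
    then show "2 \<le> card (?S x)"
      using large[OF x] finite_star[of 1 x] by (simp add: card_Diff_singleton)
  qed
  also have "\<dots> = card (\<Union>x\<in>B. ?S x)"
  proof (rule card_UN_disjoint[symmetric])
    show "finite B" by fact
    show "\<forall>x\<in>B. finite (?S x)" using finite_star by simp
    show "\<forall>x\<in>B. \<forall>y\<in>B. x \<noteq> y \<longrightarrow> ?S x \<inter> ?S y = {}"
      using pair_unique[of 1 B] B by (auto simp: star_def)
  qed
  also have "\<dots> \<le> card (T 1 - {B})"
    using fin by (intro card_mono) (auto simp: star_def)
  also have "\<dots> < card (T 1)"
    using fin B by (intro psubset_card_mono) auto
  finally show ?thesis using card_T[of 1] by simp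
qed

lemma volume_if_star_eq_2:
  assumes star2: "card (star 1 x) = 2"
  shows "2 * k \<le> m"
proof -
  obtain B1 B2 where B: "star 1 x = {B1, B2}" "B1 \<noteq> B2"
    using star2 by (auto simp: card_2_iff)
  have BT: "B1 \<in> T 1" "B2 \<in> T 1" "x \<in> B1" "x \<in> B2"
    using B by (auto simp: star_def)
  define N where "N = B1 - {x}"
  define M where "M = B2 - {x}"
  have d1: "derived 1 x = {N, M}" unfolding derived_def B(1) N_def M_def by simp
  have NM: "N \<inter> M = {}"
    using pair_unique[of 1 B1 B2] BT B(2) by (auto simp: N_def M_def)
  have size: "finite N" "finite M" "card N = k - 1" "card M = k - 1"
    using card_derived_block[of 1 _ x] d1 by auto
  have part: "partition_on (N \<union> M) (derived i x)" if "i \<in> {2, 3}" for i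
    using partition_derived[of i 1 x] that d1 by auto
  have notin: "N \<notin> derived i x" if "i \<in> {2, 3}" for i
    using derived_disjoint[of 1 i x] that d1 by auto
  have cardd: "card C = k - 1" if "i \<in> {2, 3}" "C \<in> derived i x" for i C
    using card_derived_block[of i C x] that by auto
  define E where "E = {(p, q). p \<in> N \<and> q \<in> M \<and> (\<exists>C\<in>derived 2 x \<union> derived 3 x. p \<in> C \<and> q \<in> C)}"
  have "2 * (k - 1) \<le> card E"
    unfolding E_def
    by (rule card_cross_pairs_two_partitions)
      (use size NM part notin cardd[of 2] cardd[of 3] derived_disjoint[of 2 3 x] in auto)
  also have "card E \<le> card (T 1 - {B1, B2})"
  proof (rule card_inj_on_le)
    \<comment> \<open>The block chosen exists because \<open>T 2\<close> or \<open>T 3\<close>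
      covers the pair.\<close>
    define f where "f = (\<lambda>(p, q). SOME B. B \<in> T 1 \<and> p \<in> B \<and> q \<in> B)"
    have inE: "p \<in> N \<and> q \<in> M" if "(p, q) \<in> E" for p q
      using that by (simp add: E_def)
    have f: "f (p, q) \<in> T 1 \<and> p \<in> f (p, q) \<and> q \<in> f (p, q)" if pq: "(p, q) \<in> E" for p q
    proof -
      obtain C' where "C' \<in> derived 2 x \<union> derived 3 x" and pqC': "p \<in> C'" "q \<in> C'"
        using pq unfolding E_def by blast
      then obtain i where i: "i \<in> {2, 3}" "C' \<in> derived i x" by blast
      then obtain C where "C \<in> star i x" "C' = C - {x}"
        by (auto simp: derived_def)
      then have C: "i \<in> {1..3}" "C \<in> T i" "p \<in> C" "q \<in> C"
        using pqC' i(1) by (auto simp: star_def)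
      have "p \<noteq> q" using inE[OF pq] NM by blast
      then obtain B where "B \<in> T 1" "p \<in> B" "q \<in> B"
        using pair_covered[of i 1 C p q] C by auto
      then have "\<exists>B. B \<in> T 1 \<and> p \<in> B \<and> q \<in> B" by blast
      then show ?thesis unfolding f_def case_prod_conv by (rule someI_ex)
    qed
    have out: "f (p, q) \<noteq> B1 \<and> f (p, q) \<noteq> B2" if pq: "(p, q) \<in> E" for p q
      using f[OF pq] inE[OF pq] NM by (auto simp: N_def M_def)
    show "f ` E \<subseteq> T 1 - {B1, B2}" using f out by auto
    show "inj_on f E"
    \<comment> \<open>If \<open>p\<close> and \<open>p'\<close> differed, the common block would
      share two points with \<open>B1\<close> and so equal it, which \<open>out\<close> excludes;
      likewise \<open>q\<close>, \<open>q'\<close> and \<open>B2\<close>.\<close>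
    proof (rule inj_onI, clarify)
      fix p q p' q'
      assume e: "(p, q) \<in> E" "(p', q') \<in> E" "f (p, q) = f (p', q')"
      have N: "p \<in> B1" "p' \<in> B1" "q \<in> B2" "q' \<in> B2"
        using inE[OF e(1)] inE[OF e(2)] by (auto simp: N_def M_def)
      show "p = p' \<and> q = q'"
        using pair_unique[of 1 "f (p, q)" B1 p p'] pair_unique[of 1 "f (p, q)" B2 q q']
          f[OF e(1)] f[OF e(2)] out[OF e(1)] e(3) N BT by auto
    qed
    show "finite (T 1 - {B1, B2})" using finite_T[of 1] by simp
  qed
  also have "\<dots> = m - 2"
    using BT B(2) card_T[of 1] finite_T[of 1] by (simp add: card_Diff_subset)
  \<comment> \<open>Since \<open>k > 2\<close>, the left side is positive, so \<open>m - 2\<close>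
    is not truncated.\<close>
  finally show ?thesis using k_gt_2 by linarith
qed

lemma volume_ge: "2 * k \<le> m"
proof -
  obtain B where B: "B \<in> T 1"
    using card_T[of 1] pos by fastforce
  show ?thesis
  proof (cases "\<forall>x\<in>B. 3 \<le> card (star 1 x)")
    case True
    then show ?thesis using volume_if_all_stars_large[OF B] by simp
  next
    case False
    then obtain x where "x \<in> B" "card (star 1 x) < 3" by auto
    then have "card (star 1 x) = 2" using two_le_card_star[OF B, of x] by simp
    then show ?thesis by (rule volume_if_star_eq_2)
  qed
qed

end

theorem theorem3p7:
  fixes k :: nat
  assumes "4 \<le> k"
  shows "steiner_volumes 3 2 k \<subseteq> {n. 1 \<le> n} - {1..2 * k - 1} \<and>
    (\<forall>(V :: 'a set) m T. steiner_way_trade 3 V k 2 m T \<and> 0 < m \<longrightarrow> 2 * k \<le> m)"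
\<comment> \<open>The locale leaves the point type free, so \<open>volume_ge\<close> serves both
  conjuncts.\<close>
proof (intro conjI subsetI allI impI)
  fix m assume "m \<in> steiner_volumes 3 2 k"
  then obtain V :: "nat set" and T where "steiner_way_trade 3 V k 2 m T" "0 < m"
    by (auto simp: steiner_volumes_def)
  then have "2 * k \<le> m"
    using steiner_3_trade.volume_ge[OF steiner_3_trade.intro] by metis
  then show "m \<in> {n. 1 \<le> n} - {1..2 * k - 1}"
    using assms by auto
next
  fix V :: "'a set" and m T
  assume "steiner_way_trade 3 V k 2 m T \<and> 0 < m"
  then show "2 * k \<le> m"
    using steiner_3_trade.volume_ge[OF steiner_3_trade.intro] by metis
qed

end
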